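(* Let $V$ be a Hermitian vector space of dimension $M<\infty$, let $J$ be $\mathbb{R}$ or an interval in $\mathbb{R}$, and let $U(x)$, $x\in J$, be a monotone unitary family on $V$. Let $d_{\min},d_{\max},d_2>0$ be constants such that $$d_{\min} I\le D(x)\le d_{\max} I,\qquad \|U''(x)\|\le d_2\qquad\text{for all }x\in J.$$ Let $I_0\subset J$ be an interval of length at most $\frac{2d_{\min}}{d_2M}$. Then the spaces $W(x)$, $x\in I_0$, are independent; that is, if $\phi_x\in W(x)$ for each $x\in I_0\cap\mathcal{Z}$ and $\sum_{x}\phi_x=0$, then $\phi_x=0$ for all $x$.
   Context: A Hermitian vector space is a finite-dimensional complex vector space with a Hermitian inner product. A unitary family on $V$ is a family of unitary operators $U(x)$ on $V$ depending real analytically on $x\in J$. Put $D(x):=\frac{1}{i}U'(x)U(x)^{-1}$, where $'$ is the derivative in $x$; this is a symmetric (self-adjoint) operator. The family is monotone if $D(x)$ is positive (i.e. positive definite) for every $x$. Inequalities between symmetric operators are in the sense of quadratic forms, and $\|\cdot\|$ is the operator norm. In $d_{\min}I$ and $d_{\max}I$, $I$ is the identity. Notation: $W(x):=\ker(I-U(x))$ and $\mathcal{Z}:=\{x\in J:\ W(x)\ne\{0\}\}$ (only finitely many $\phi_x$ occur in the sum when $I_0$ is bounded, since $\mathcal{Z}$ is discrete; in general sums are understood as finite). *)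

theory Defs
  imports "HOL-Analysis.Analysis"
begin

section \<open>Hermitian vector spaces\<close>

text \<open>The norm of the underlying real normed space is required to be the one induced by the
  Hermitian inner product. Then the norm of the type of bounded linear maps is the operator norm,
  and derivatives of operator-valued functions are taken with respect to it.
  The inner product is linear in its first argument.\<close>

class hermitian_space = real_normed_vector +
  fixes scaleC :: "complex \<Rightarrow> 'a \<Rightarrow> 'a"  (infixr \<open>*\<^sub>C\<close> 75)
    and cinner :: "'a \<Rightarrow> 'a \<Rightarrow> complex"
  assumes scaleC_add_right: "a *\<^sub>C (v + w) = a *\<^sub>C v + a *\<^sub>C w"
    and scaleC_add_left: "(a + b) *\<^sub>C v = a *\<^sub>C v + b *\<^sub>C v"
    and scaleC_scaleC: "a *\<^sub>C (b *\<^sub>C v) = (a * b) *\<^sub>C v"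
    and scaleC_one: "1 *\<^sub>C v = v"
    and scaleC_of_real: "complex_of_real r *\<^sub>C v = r *\<^sub>R v"
    and cinner_add_left: "cinner (u + v) w = cinner u w + cinner v w"
    and cinner_scaleC_left: "cinner (a *\<^sub>C v) w = a * cinner v w"
    and cinner_commute: "cinner v w = cnj (cinner w v)"
    and norm_eq_sqrt_cinner: "norm v = sqrt (Re (cinner v v))"
    and finite_dimensional: "\<exists>B. finite B \<and> (\<forall>v. \<exists>c. v = (\<Sum>b\<in>B. c b *\<^sub>C b))"

global_interpretation complex_vector: vector_space "scaleC :: complex \<Rightarrow> 'a \<Rightarrow> 'a::hermitian_space"
  by unfold_locales (simp_all add: scaleC_add_right scaleC_add_left scaleC_scaleC scaleC_one)

instantiation complex :: hermitian_space
begin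
definition scaleC_complex :: "complex \<Rightarrow> complex \<Rightarrow> complex" where
  "scaleC_complex a v = a * v"
definition cinner_complex :: "complex \<Rightarrow> complex \<Rightarrow> complex" where
  "cinner_complex v w = v * cnj w"
instance
proof
  show "\<exists>B. finite B \<and> (\<forall>v::complex. \<exists>c. v = (\<Sum>b\<in>B. c b *\<^sub>C b))"
    by (rule exI[of _ "{1}"]) (auto simp: scaleC_complex_def)
qed (auto simp: scaleC_complex_def cinner_complex_def algebra_simps scaleR_conv_of_real
    cmod_def power2_eq_square)
end

instantiation vec :: (hermitian_space, finite) hermitian_space
begin
definition scaleC_vec :: "complex \<Rightarrow> ('a, 'b) vec \<Rightarrow> ('a, 'b) vec" where
  "scaleC_vec a v = (\<chi> i. a *\<^sub>C (v $ i))"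
definition cinner_vec :: "('a, 'b) vec \<Rightarrow> ('a, 'b) vec \<Rightarrow> complex" where
  "cinner_vec v w = (\<Sum>i\<in>UNIV. cinner (v $ i) (w $ i))"
instance
proof
  show "cinner v w = cnj (cinner w v)" for v w :: "('a, 'b) vec"
    by (simp add: cinner_vec_def cnj_sum flip: cinner_commute)
  have "0 \<le> sqrt (Re (cinner x x))" for x :: 'a
    using norm_ge_zero[of x] by (simp add: norm_eq_sqrt_cinner)
  then show "norm v = sqrt (Re (cinner v v))" for v :: "('a, 'b) vec"
    by (simp add: cinner_vec_def norm_vec_def L2_set_def norm_eq_sqrt_cinner)
  show "\<exists>B. finite B \<and> (\<forall>v::('a, 'b) vec. \<exists>c. v = (\<Sum>b\<in>B. c b *\<^sub>C b))"
  proof -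
    obtain B0 :: "'a set" where "finite B0"
      and B0: "\<And>v. \<exists>c. v = (\<Sum>b\<in>B0. c b *\<^sub>C b)"
      using finite_dimensional by blast
    define B where "B = B0 - {0}"
    have fin: "finite B" and nz: "0 \<notin> B"
      using \<open>finite B0\<close> by (auto simp: B_def)
    have scale0: "a *\<^sub>C (0::'a) = 0" for a
      using scaleC_add_right[of a "0::'a" 0] by simp
    have B: "\<exists>c. v = (\<Sum>b\<in>B. c b *\<^sub>C b)" for v
    proof -
      obtain c where "v = (\<Sum>b\<in>B0. c b *\<^sub>C b)" using B0 by blast
      also have "\<dots> = (\<Sum>b\<in>B. c b *\<^sub>C b)"
        unfolding B_def by (rule sum.mono_neutral_right) (auto simp: \<open>finite B0\<close> scale0)
      finally show ?thesis by blast
    qed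
    define f where "f = (\<lambda>(i::'b, b::'a). axis i b)"
    have inj: "inj_on f (UNIV \<times> B)"
      using nz by (auto simp: f_def inj_on_def axis_eq_axis)
    have "\<exists>c. v = (\<Sum>b\<in>f ` (UNIV \<times> B). c b *\<^sub>C b)" for v :: "('a, 'b) vec"
    proof -
      have "\<forall>i. \<exists>c. v $ i = (\<Sum>b\<in>B. c b *\<^sub>C b)" using B by blast
      then obtain c where c: "\<And>i. v $ i = (\<Sum>b\<in>B. c i b *\<^sub>C b)" by metis
      define d where "d = (\<lambda>w. case the_inv_into (UNIV \<times> B) f w of (i, b) \<Rightarrow> c i b)"
      have "(\<Sum>b\<in>f ` (UNIV \<times> B). d b *\<^sub>C b) = (\<Sum>p\<in>UNIV \<times> B. d (f p) *\<^sub>C f p)"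
        using inj by (simp add: sum.reindex)
      also have "\<dots> = (\<Sum>(i, b)\<in>UNIV \<times> B. c i b *\<^sub>C axis i b)"
        using inj by (intro sum.cong) (auto simp: d_def the_inv_into_f_f f_def)
      also have "\<dots> = (\<Sum>i\<in>UNIV. \<Sum>b\<in>B. c i b *\<^sub>C axis i b)"
        by (simp add: sum.cartesian_product)
      also have "\<dots> = v"
      proof (rule vec_eq_iff[THEN iffD2], rule allI)
        fix j
        have "(\<Sum>i\<in>UNIV. \<Sum>b\<in>B. c i b *\<^sub>C axis i b) $ j =
            (\<Sum>i\<in>UNIV. if i = j then \<Sum>b\<in>B. c i b *\<^sub>C b else 0)"
          unfolding sum_component
          by (rule sum.cong) (auto simp: scaleC_vec_def axis_def scale0)
        also have "\<dots> = v $ j" by (simp add: c)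
        finally show "(\<Sum>i\<in>UNIV. \<Sum>b\<in>B. c i b *\<^sub>C axis i b) $ j = v $ j" .
      qed
      finally show ?thesis by metis
    qed
    then show ?thesis using fin by (intro exI[of _ "f ` (UNIV \<times> B)"]) auto
  qed
qed (simp_all add: vec_eq_iff scaleC_vec_def cinner_vec_def scaleC_add_right scaleC_add_left
    scaleC_scaleC scaleC_one scaleC_of_real cinner_add_left cinner_scaleC_left sum.distrib
    sum_distrib_left)
end


section \<open>Operators and monotone unitary families\<close>

definition unitary_operator :: "('a::hermitian_space \<Rightarrow>\<^sub>L 'a) \<Rightarrow> bool" where
  "unitary_operator T \<longleftrightarrow>
     (\<forall>a v. T (a *\<^sub>C v) = a *\<^sub>C T v) \<and>
     (\<forall>v w. cinner (T v) (T w) = cinner v w) \<and>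
     surj (blinfun_apply T)"

text \<open>Quadratic forms of symmetric operators are real-valued, so taking the real part loses
  nothing.\<close>

definition op_le :: "('a::hermitian_space \<Rightarrow> 'a) \<Rightarrow> ('a \<Rightarrow> 'a) \<Rightarrow> bool" where
  "op_le A B \<longleftrightarrow> (\<forall>v. Re (cinner (A v) v) \<le> Re (cinner (B v) v))"

definition positive_operator :: "('a::hermitian_space \<Rightarrow> 'a) \<Rightarrow> bool" where
  "positive_operator A \<longleftrightarrow> (\<forall>v. v \<noteq> 0 \<longrightarrow> 0 < Re (cinner (A v) v))"

text \<open>Points of \<open>J\<close> need not be interior: the power series only has to represent \<open>f\<close> at those
  nearby points that belong to \<open>J\<close>.\<close>

definition real_analytic_on :: "(real \<Rightarrow> 'b::real_normed_vector) \<Rightarrow> real set \<Rightarrow> bool" where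
  "real_analytic_on f J \<longleftrightarrow>
     (\<forall>x\<in>J. \<exists>c r. 0 < r \<and>
       (\<forall>y\<in>J. \<bar>y - x\<bar> < r \<longrightarrow> (\<lambda>n. (y - x) ^ n *\<^sub>R c n) sums f y))"

text \<open>Derivatives are relative to \<open>J\<close>, hence one-sided at end points belonging to \<open>J\<close>.\<close>

definition deriv_on :: "real set \<Rightarrow> (real \<Rightarrow> 'b::real_normed_vector) \<Rightarrow> real \<Rightarrow> 'b" where
  "deriv_on J f x = vector_derivative f (at x within J)"

definition velocity ::
    "real set \<Rightarrow> (real \<Rightarrow> 'a::hermitian_space \<Rightarrow>\<^sub>L 'a) \<Rightarrow> real \<Rightarrow> 'a \<Rightarrow> 'a" where
  "velocity J U x = (\<lambda>v. (1 / \<i>) *\<^sub>C deriv_on J U x (inv (blinfun_apply (U x)) v))"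

definition unitary_family ::
    "real set \<Rightarrow> (real \<Rightarrow> 'a::hermitian_space \<Rightarrow>\<^sub>L 'a) \<Rightarrow> bool" where
  "unitary_family J U \<longleftrightarrow> (\<forall>x\<in>J. unitary_operator (U x)) \<and> real_analytic_on U J"

definition monotone_unitary_family ::
    "real set \<Rightarrow> (real \<Rightarrow> 'a::hermitian_space \<Rightarrow>\<^sub>L 'a) \<Rightarrow> bool" where
  "monotone_unitary_family J U \<longleftrightarrow>
     unitary_family J U \<and> (\<forall>x\<in>J. positive_operator (velocity J U x))"

definition fixed_space :: "(real \<Rightarrow> 'a::hermitian_space \<Rightarrow>\<^sub>L 'a) \<Rightarrow> real \<Rightarrow> 'a set" where
  "fixed_space U x = {v. (id_blinfun - U x) v = 0}"

definition singular_points ::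
    "real set \<Rightarrow> (real \<Rightarrow> 'a::hermitian_space \<Rightarrow>\<^sub>L 'a) \<Rightarrow> real set" where
  "singular_points J U = {x \<in> J. fixed_space U x \<noteq> {0}}"

definition independent_spaces :: "'i set \<Rightarrow> ('i \<Rightarrow> 'b::ab_group_add set) \<Rightarrow> bool" where
  "independent_spaces I W \<longleftrightarrow>
     (\<forall>\<phi>. (\<forall>x\<in>I. \<phi> x \<in> W x) \<and> finite {x\<in>I. \<phi> x \<noteq> 0} \<and>
        (\<Sum>x\<in>{x\<in>I. \<phi> x \<noteq> 0}. \<phi> x) = 0 \<longrightarrow> (\<forall>x\<in>I. \<phi> x = 0))"

end

theory Submission
  imports Defs
begin

text \<open>
  Let \<open>v\<close> be fixed by \<open>U(x)\<close> and \<open>w\<close> by \<open>U(y)\<close>. By unitarity \<open>\<langle>U(x)v, w\<rangle> = \<langle>v, w\<rangle> = \<langle>U(y)v, w\<rangle>\<close>,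
  so Taylor's formula at \<open>y\<close> gives \<open>|\<langle>U'(y)v, w\<rangle>| \<le> |x - y| d\<^sub>2 \<parallel>v\<parallel> \<parallel>w\<parallel> / 2\<close>, while
  \<open>Im \<langle>U'(y)w, w\<rangle> \<ge> d\<^sub>m\<^sub>i\<^sub>n \<parallel>w\<parallel>\<^sup>2\<close>. A relation \<open>\<Sum> \<phi>\<^sub>x = 0\<close> with the least number of nonzero terms has
  at most \<open>M + 1\<close> of them. Pairing it with \<open>U'(y)\<^sup>*\<phi>\<^sub>y\<close>, where \<open>\<phi>\<^sub>y\<close> is a longest term, yields
  \<open>d\<^sub>m\<^sub>i\<^sub>n \<le> (d\<^sub>2/2) \<Sum> |x - y|\<close>, the sum being over at most \<open>M\<close> points \<open>x\<close>. The right-hand side is less than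
  \<open>d\<^sub>m\<^sub>i\<^sub>n\<close> unless all \<open>x\<close> lie at the maximal distance from \<open>y\<close>, which forces a relation of two
  terms. Then both operators fix one vector \<open>\<phi>\<close>, and \<open>Im \<langle>U(t)\<phi>, \<phi>\<rangle>\<close> would take equal values at the
  two points although the bound on \<open>U''\<close> keeps its slope positive in between, except possibly at the midpoint.
\<close>

section \<open>The real inner product underlying the Hermitian one\<close>

text \<open>Everything is done over the reals; the imaginary part of \<open>\<langle>v, w\<rangle>\<close> is the value of this form at
  \<open>v\<close> and \<open>\<i>w\<close>.\<close>

definition rinner :: "'a::hermitian_space \<Rightarrow> 'a \<Rightarrow> real" where
  "rinner v w = Re (cinner v w)"

lemma rinner_commute: "rinner v w = rinner w v"
  using cinner_commute[of v w] by (simp add: rinner_def)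

lemma rinner_self: "rinner v v = (norm v)\<^sup>2"
proof -
  \<comment> \<open>\<open>sqrt\<close> is negative at negative arguments, so the norm axiom yields
    \<open>rinner v v \<ge> 0\<close> only through the non-negativity of the norm.\<close>
  have "0 \<le> sqrt (rinner v v)"
    using norm_ge_zero[of v] by (simp add: norm_eq_sqrt_cinner rinner_def)
  then show ?thesis
    by (simp add: norm_eq_sqrt_cinner rinner_def)
qed

lemma rinner_add_left: "rinner (u + v) w = rinner u w + rinner v w"
  by (simp add: rinner_def cinner_add_left)

lemma rinner_scaleR_left: "rinner (r *\<^sub>R v) w = r * rinner v w"
  by (simp add: rinner_def cinner_scaleC_left flip: scaleC_of_real)

text \<open>Cauchy-Schwarz comes from the triangle inequality, which the class provides: compare the
  expansion of the squared norm of \<open>v + w\<close> with the square of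
  \<open>norm v + norm w\<close>. Replacing \<open>v\<close> by \<open>- v\<close> gives the
  absolute value.\<close>

lemma rinner_le_norm: "\<bar>rinner v w\<bar> \<le> norm v * norm w"
proof -
  have le: "rinner v w \<le> norm v * norm w" for v w :: 'a
  proof -
    have "(norm (v + w))\<^sup>2 = (norm v)\<^sup>2 + 2 * rinner v w + (norm w)\<^sup>2"
      using rinner_commute[of _ "v + w"]
      by (simp add: rinner_add_left rinner_commute[of v w] flip: rinner_self)
    moreover have "(norm (v + w))\<^sup>2 \<le> (norm v + norm w)\<^sup>2"
      by (simp add: norm_triangle_ineq power_mono)
    ultimately show ?thesis by (simp add: power2_sum)
  qed
  have "rinner (- v) w = - rinner v w"
    using rinner_scaleR_left[of "-1" v w] by simp
  then show ?thesis
    using le[of v w] le[of "- v" w] by simp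
qed

lemma bounded_bilinear_rinner: "bounded_bilinear (rinner :: 'a::hermitian_space \<Rightarrow> 'a \<Rightarrow> real)"
proof
  fix r :: real and u v w :: 'a
  show "rinner (u + v) w = rinner u w + rinner v w"
    by (rule rinner_add_left)
  then show "rinner w (u + v) = rinner w u + rinner w v"
    by (simp add: rinner_commute)
  show "rinner (r *\<^sub>R v) w = r *\<^sub>R rinner v w"
    by (simp add: rinner_scaleR_left)
  then show "rinner w (r *\<^sub>R v) = r *\<^sub>R rinner w v"
    by (simp add: rinner_commute)
  show "\<exists>K. \<forall>v w::'a. norm (rinner v w) \<le> norm v * norm w * K"
    by (rule exI[of _ 1]) (simp add: rinner_le_norm)
qed

interpretation rinner: bounded_bilinear "rinner :: 'a::hermitian_space \<Rightarrow> 'a \<Rightarrow> real"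
  by (rule bounded_bilinear_rinner)

section \<open>Real frames for vectors and operators\<close>

text \<open>A real frame reduces the derivatives of operator-valued analytic functions to termwise
  differentiation of real power series, without using completeness.\<close>

lemma orthonormal_frame_of_finite:
  fixes S :: "'a::hermitian_space set"
  assumes "finite S"
  shows "\<exists>E. finite E \<and> (\<forall>e\<in>E. \<forall>e'\<in>E. rinner e e' = (if e = e' then 1 else 0)) \<and>
    (\<forall>v\<in>S. v = (\<Sum>e\<in>E. rinner v e *\<^sub>R e))"
  using assms
proof (induction S)
  case empty
  show ?case by (rule exI[of _ "{}"]) simp
next
  case (insert s S)
  then obtain E where E: "finite E" "\<And>e e'. e \<in> E \<Longrightarrow> e' \<in> E \<Longrightarrow> rinner e e' = (if e = e' then 1 else 0)"
    and S: "\<And>v. v \<in> S \<Longrightarrow> v = (\<Sum>e\<in>E. rinner v e *\<^sub>R e)" by blast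
  define P where "P v = (\<Sum>e\<in>E. rinner v e *\<^sub>R e)" for v
  \<comment> \<open>Gram-Schmidt: if this residual vanishes, \<open>E\<close> already reproduces
    \<open>s\<close>; otherwise its normalization joins \<open>E\<close>.\<close>
  define z where "z = s - P s"
  have z_orth: "rinner z e = 0" if "e \<in> E" for e
  proof -
    have "rinner (P s) e = (\<Sum>i\<in>E. if i = e then rinner s i else 0)"
      unfolding P_def rinner.sum_left rinner_scaleR_left
      by (rule sum.cong) (use E(2)[OF _ that] in auto)
    also have "\<dots> = rinner s e" using E(1) that by simp
    finally show ?thesis by (simp add: z_def rinner.diff_left)
  qed
  show ?case
  proof (cases "z = 0")
    case True
    then show ?thesis using E S by (intro exI[of _ E]) (auto simp: z_def P_def)
  next
    case False
    define w where "w = (1 / norm z) *\<^sub>R z"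
    have w_orth: "rinner w e = 0" if "e \<in> E" for e
      using that by (simp add: w_def rinner_scaleR_left z_orth)
    then have w_orth': "rinner e w = 0" if "e \<in> E" for e
      using that rinner_commute[of e w] by simp
    have ww: "rinner w w = 1"
      using False by (simp add: w_def rinner_self)
    have "w \<notin> E" using w_orth ww by force
    then have P': "(\<Sum>e\<in>insert w E. rinner v e *\<^sub>R e) = rinner v w *\<^sub>R w + P v" for v
      using E by (simp add: P_def)
    have Pw: "rinner (P v) w = 0" for v
      unfolding P_def rinner.sum_left rinner_scaleR_left
      by (simp add: w_orth')
    have "rinner s w = rinner z w"
      using Pw[of s] by (simp add: z_def rinner.diff_left)
    then have "rinner s w *\<^sub>R w = z"
      using False by (simp add: w_def rinner.scaleR_right rinner_self power2_eq_square)
    then have "s = rinner s w *\<^sub>R w + P s" by (simp add: z_def)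
    moreover have "v = rinner v w *\<^sub>R w + P v" if "v \<in> S" for v
      using S[OF that] Pw[of v] by (simp add: P_def)
    ultimately show ?thesis
      using E w_orth w_orth' ww P' \<open>w \<notin> E\<close>
      by (intro exI[of _ "insert w E"]) auto
  qed
qed

text \<open>Over the reals a complex generating set together with its multiples by i spans the whole
  space, so a frame that reproduces this finite set reproduces every vector.\<close>

lemma rinner_frame:
  obtains E :: "'a::hermitian_space set"
  where "finite E" "\<And>v. v = (\<Sum>e\<in>E. rinner v e *\<^sub>R e)"
proof -
  obtain B :: "'a set" where B: "finite B" "\<And>v. \<exists>c. v = (\<Sum>b\<in>B. c b *\<^sub>C b)"
    using finite_dimensional by blast
  obtain E where E: "finite E"
    "\<And>v. v \<in> B \<union> (\<lambda>b. \<i> *\<^sub>C b) ` B \<Longrightarrow> v = (\<Sum>e\<in>E. rinner v e *\<^sub>R e)"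
    using orthonormal_frame_of_finite[of "B \<union> (\<lambda>b. \<i> *\<^sub>C b) ` B"] B(1) by blast
  define X where "X = {v. v = (\<Sum>e\<in>E. rinner v e *\<^sub>R e)}"
  have X: "subspace X"
    unfolding X_def subspace_def
    by (auto simp: rinner.zero_left rinner_add_left rinner_scaleR_left scaleR_add_left sum.distrib
        simp flip: scaleR_scaleR scaleR_sum_right)
  have "c *\<^sub>C b \<in> X" if "b \<in> B" for b c
  proof -
    have "c *\<^sub>C b = complex_of_real (Re c) *\<^sub>C b + complex_of_real (Im c) *\<^sub>C \<i> *\<^sub>C b"
      by (simp add: scaleC_scaleC mult.commute flip: scaleC_add_left complex_eq)
    also have "\<dots> = Re c *\<^sub>R b + Im c *\<^sub>R \<i> *\<^sub>C b"
      by (simp only: scaleC_of_real)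
    also have "\<dots> \<in> X"
      using that E(2) by (intro subspace_add[OF X] subspace_scale[OF X]) (auto simp: X_def)
    finally show ?thesis .
  qed
  then have "v \<in> X" for v
    using B(2)[of v] by (auto intro: subspace_sum[OF X])
  then show ?thesis using E(1) that by (simp add: X_def)
qed

text \<open>Matrix units: \<open>L (e, e')\<close> reads off a matrix entry and
  \<open>B (e, e')\<close> is the rank-one operator belonging to it. Boundedness of the coordinates
  lets them pass through infinite sums.\<close>

lemma blinfun_frame:
  obtains K :: "('a::hermitian_space \<times> 'a) set" and L :: "_ \<Rightarrow> ('a \<Rightarrow>\<^sub>L 'a) \<Rightarrow> real" and B
  where "finite K" "\<And>k. bounded_linear (L k)" "\<And>A. A = (\<Sum>k\<in>K. L k A *\<^sub>R B k)"
proof -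
  obtain E :: "'a set" where E: "finite E" "\<And>v. v = (\<Sum>e\<in>E. rinner v e *\<^sub>R e)"
    using rinner_frame by blast
  define L :: "'a \<times> 'a \<Rightarrow> ('a \<Rightarrow>\<^sub>L 'a) \<Rightarrow> real" where "L = (\<lambda>(e, e') A. rinner (A e) e')"
  define B :: "'a \<times> 'a \<Rightarrow> ('a \<Rightarrow>\<^sub>L 'a)" where "B = (\<lambda>(e, e'). Blinfun (\<lambda>v. rinner v e *\<^sub>R e'))"
  have B: "B (e, e') v = rinner v e *\<^sub>R e'" for e e' v
  proof -
    have "bounded_linear (\<lambda>v. rinner v e *\<^sub>R e')"
      by (intro bounded_linear_scaleR_const rinner.bounded_linear_left)
    then show ?thesis by (simp add: B_def bounded_linear_Blinfun_apply)
  qed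
  have "A = (\<Sum>k\<in>E \<times> E. L k A *\<^sub>R B k)" for A
  proof (rule blinfun_eqI)
    fix v
    have "(\<Sum>k\<in>E \<times> E. L k A *\<^sub>R B k) v = (\<Sum>e\<in>E. \<Sum>e'\<in>E. (rinner v e * rinner (A e) e') *\<^sub>R e')"
      by (simp add: blinfun.sum_left blinfun.scaleR_left L_def B sum.cartesian_product'
        mult.commute split_def flip: B)
         (simp add: B mult.commute)
    also have "\<dots> = (\<Sum>e\<in>E. rinner v e *\<^sub>R A e)"
      by (rule sum.cong[OF refl], subst E(2)[of "blinfun_apply A _"]) (simp add: scaleR_sum_right)
    also have "\<dots> = A v"
      by (subst (2) E(2)[of v]) (simp add: blinfun.sum_right blinfun.scaleR_right)
    finally show "A v = (\<Sum>k\<in>E \<times> E. L k A *\<^sub>R B k) v" by simp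
  qed
  moreover have "bounded_linear (L k)" for k
    by (auto simp: L_def split_def intro!: bounded_linear_compose[OF rinner.bounded_linear_left]
        blinfun.bounded_linear_left)
  ultimately show ?thesis using that[of "E \<times> E" L B] E(1) by blast
qed

section \<open>Differentiation of analytic maps\<close>

text \<open>Each coordinate of \<open>f\<close> is locally a real power series, which may be
  differentiated termwise; finitely many coordinates are then reassembled. Analyticity of the
  derivative makes the argument repeatable, which supplies second derivatives.\<close>

lemma real_analytic_on_deriv:
  fixes f :: "real \<Rightarrow> 'b::real_normed_vector" and L :: "'k \<Rightarrow> 'b \<Rightarrow> real"
  assumes f: "real_analytic_on f J"
    and J: "\<And>x. x \<in> J \<Longrightarrow> x islimpt J"
    and K: "finite K" and L: "\<And>k. bounded_linear (L k)"
    and frame: "\<And>v. v = (\<Sum>k\<in>K. L k v *\<^sub>R B k)"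
  shows "real_analytic_on (deriv_on J f) J"
    and "x \<in> J \<Longrightarrow> (f has_vector_derivative deriv_on J f x) (at x within J)"
proof -
  have *: "\<exists>c \<rho>. 0 < \<rho> \<and> (\<forall>y\<in>J. \<bar>y - x\<bar> < \<rho> \<longrightarrow>
      (\<lambda>n. (y - x) ^ n *\<^sub>R c n) sums deriv_on J f y \<and>
      (f has_vector_derivative deriv_on J f y) (at y within J))" if x: "x \<in> J" for x
  proof -
    obtain c r where r: "0 < r"
      and c: "\<And>y. y \<in> J \<Longrightarrow> \<bar>y - x\<bar> < r \<Longrightarrow> (\<lambda>n. (y - x) ^ n *\<^sub>R c n) sums f y"
      using f x unfolding real_analytic_on_def by blast
    \<comment> \<open>Convergence is known only at points of \<open>J\<close>. A single point
      \<open>z \<noteq> x\<close> of \<open>J\<close> gives convergence on the whole open interval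
      of radius \<open>\<bar>z - x\<bar>\<close> about \<open>x\<close>, including points outside
      \<open>J\<close>, so the coordinate series have two-sided derivatives there.\<close>
    obtain z where z: "z \<in> J" "z \<noteq> x" "\<bar>z - x\<bar> < r"
      using J[OF x] r unfolding islimpt_approachable dist_real_def by blast
    define \<rho> where "\<rho> = \<bar>z - x\<bar>"
    have \<rho>: "0 < \<rho>" "\<rho> < r" using z by (auto simp: \<rho>_def)
    define a where "a k n = L k (c n)" for k n
    define p where "p k t = (\<Sum>n. a k n * t ^ n)" for k t
    define p' where "p' k t = (\<Sum>n. diffs (a k) n * t ^ n)" for k t
    have sums: "(\<lambda>n. a k n * (y - x) ^ n) sums L k (f y)" if "y \<in> J" "\<bar>y - x\<bar> < r" for k y
      using bounded_linear.sums[OF L c[OF that], of k]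
      by (simp add: a_def linear_cmul[OF bounded_linear.linear[OF L]] mult.commute)
    have summ: "summable (\<lambda>n. a k n * (z - x) ^ n)" for k
      using sums[OF z(1,3)] by (rule sums_summable)
    have fp: "f y = (\<Sum>k\<in>K. p k (y - x) *\<^sub>R B k)" if "y \<in> J" "\<bar>y - x\<bar> < \<rho>" for y
    proof -
      have "p k (y - x) = L k (f y)" for k
        unfolding p_def using sums[OF that(1), of k] that(2) \<rho> by (simp add: sums_iff)
      then show ?thesis using frame[of "f y"] by (simp only:)
    qed
    have p_deriv: "(p k has_real_derivative p' k t) (at t)" if "\<bar>t\<bar> < \<rho>" for k t
      unfolding p_def p'_def
      by (rule termdiffs_strong[OF summ]) (use that in \<open>simp add: \<rho>_def\<close>)
    have p'_sums: "(\<lambda>n. diffs (a k) n * t ^ n) sums p' k t" if "\<bar>t\<bar> < \<rho>" for k t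
      unfolding p'_def
    proof (rule summable_sums, rule termdiff_converges[where K = \<rho>])
      fix u :: real assume "norm u < \<rho>"
      then show "summable (\<lambda>n. a k n * u ^ n)"
        by (intro powser_inside[OF summ]) (simp add: \<rho>_def)
    qed (use that in simp)
    have "(\<lambda>n. (y - x) ^ n *\<^sub>R (\<Sum>k\<in>K. diffs (a k) n *\<^sub>R B k)) sums deriv_on J f y \<and>
      (f has_vector_derivative deriv_on J f y) (at y within J)"
      if y: "y \<in> J" "\<bar>y - x\<bar> < \<rho>" for y
    proof -
      let ?D = "\<Sum>k\<in>K. p' k (y - x) *\<^sub>R B k"
      have "((\<lambda>y. \<Sum>k\<in>K. p k (y - x) *\<^sub>R B k) has_vector_derivative ?D) (at y within J)"
      proof (rule has_vector_derivative_sum)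
        fix k
        have "((\<lambda>y. p k (y - x)) has_real_derivative p' k (y - x) * 1) (at y)"
          by (rule DERIV_chain2[where g = "\<lambda>y. y - x", OF p_deriv[OF y(2)]])
            (auto intro!: derivative_eq_intros)
        then have "((\<lambda>y. p k (y - x)) has_vector_derivative p' k (y - x)) (at y within J)"
          by (simp add: has_real_derivative_iff_has_vector_derivative
              has_vector_derivative_at_within)
        then show "((\<lambda>y. p k (y - x) *\<^sub>R B k) has_vector_derivative p' k (y - x) *\<^sub>R B k)
            (at y within J)"
          by (rule bounded_linear.has_vector_derivative[OF bounded_linear_scaleR_left])
      qed
      then have D: "(f has_vector_derivative ?D) (at y within J)"
      proof (rule has_vector_derivative_transform_within[where d = "\<rho> - \<bar>y - x\<bar>"])
        fix u assume "u \<in> J" "dist u y < \<rho> - \<bar>y - x\<bar>"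
        then show "(\<Sum>k\<in>K. p k (u - x) *\<^sub>R B k) = f u"
          by (intro fp[symmetric]) (auto simp: dist_real_def)
      qed (use y in auto)
      \<comment> \<open>Since \<open>y\<close> is a limit point of \<open>J\<close>, the derivative
        within \<open>J\<close> is unique.\<close>
      moreover have "deriv_on J f y = ?D"
        unfolding deriv_on_def using J[OF y(1)] D
        by (intro vector_derivative_within) (simp add: trivial_limit_within)
      moreover have "(\<lambda>n. (\<Sum>k\<in>K. (diffs (a k) n * (y - x) ^ n) *\<^sub>R B k)) sums ?D"
        by (rule sums_sum, rule bounded_linear.sums[OF bounded_linear_scaleR_left],
            rule p'_sums[OF y(2)])
      moreover have "(\<Sum>k\<in>K. (diffs (a k) n * (y - x) ^ n) *\<^sub>R B k) =
          (y - x) ^ n *\<^sub>R (\<Sum>k\<in>K. diffs (a k) n *\<^sub>R B k)" for n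
        by (simp add: scaleR_sum_right mult.commute)
      ultimately show ?thesis by simp
    qed
    then show ?thesis
      by (intro exI[of _ "\<lambda>n. \<Sum>k\<in>K. diffs (a k) n *\<^sub>R B k"] exI[of _ \<rho>])
        (use \<rho>(1) in simp)
  qed
  show "real_analytic_on (deriv_on J f) J"
    unfolding real_analytic_on_def
  proof
    fix x assume "x \<in> J"
    from *[OF this] obtain c \<rho> where "0 < \<rho>"
      "\<forall>y\<in>J. \<bar>y - x\<bar> < \<rho> \<longrightarrow> (\<lambda>n. (y - x) ^ n *\<^sub>R c n) sums deriv_on J f y \<and>
        (f has_vector_derivative deriv_on J f y) (at y within J)" by (elim exE conjE)
    then show "\<exists>c r. 0 < r \<and>
        (\<forall>y\<in>J. \<bar>y - x\<bar> < r \<longrightarrow> (\<lambda>n. (y - x) ^ n *\<^sub>R c n) sums deriv_on J f y)"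
      by (intro exI[of _ c] exI[of _ \<rho>]) simp
  qed
  show "(f has_vector_derivative deriv_on J f x) (at x within J)" if "x \<in> J"
  proof -
    from *[OF that] obtain c \<rho> where "0 < \<rho>"
      "\<forall>y\<in>J. \<bar>y - x\<bar> < \<rho> \<longrightarrow> (\<lambda>n. (y - x) ^ n *\<^sub>R c n) sums deriv_on J f y \<and>
        (f has_vector_derivative deriv_on J f y) (at y within J)" by (elim exE conjE)
    then show ?thesis using that by simp
  qed
qed

lemma real_analytic_on_blinfun_derivatives:
  fixes U :: "real \<Rightarrow> 'a::hermitian_space \<Rightarrow>\<^sub>L 'a"
  assumes U: "real_analytic_on U J" and J: "\<And>x. x \<in> J \<Longrightarrow> x islimpt J" and "x \<in> J"
  shows "(U has_vector_derivative deriv_on J U x) (at x within J)"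
    and "(deriv_on J U has_vector_derivative deriv_on J (deriv_on J U) x) (at x within J)"
proof -
  obtain K :: "('a \<times> 'a) set" and L :: "_ \<Rightarrow> ('a \<Rightarrow>\<^sub>L 'a) \<Rightarrow> real" and B where
    frame: "finite K" "\<And>k. bounded_linear (L k)" "\<And>A. A = (\<Sum>k\<in>K. L k A *\<^sub>R B k)"
    using blinfun_frame by metis
  note deriv = real_analytic_on_deriv[OF _ J frame]
  show "(U has_vector_derivative deriv_on J U x) (at x within J)"
    using deriv(2)[OF U] \<open>x \<in> J\<close> by blast
  show "(deriv_on J U has_vector_derivative deriv_on J (deriv_on J U) x) (at x within J)"
    using deriv(2)[OF deriv(1)[OF U]] \<open>x \<in> J\<close> by blast
qed

section \<open>Linear relations with few terms\<close>

text \<open>Dependence of the set of values ignores repetitions in the family. A coincidence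
  \<open>\<phi> x = \<phi> y\<close> is therefore treated apart, with coefficients 1 and -1.\<close>

lemma dim_less_card_imp_relation:
  fixes \<phi> :: "'i \<Rightarrow> 'a::hermitian_space"
  assumes "finite T" and "complex_vector.dim (UNIV :: 'a set) < card T"
  obtains c where "\<exists>x\<in>T. c x \<noteq> 0" "(\<Sum>x\<in>T. c x *\<^sub>C \<phi> x) = 0"
proof (cases "inj_on \<phi> T")
  case True
  obtain B :: "'a set" where B: "finite B" "\<And>v. \<exists>c. v = (\<Sum>b\<in>B. c b *\<^sub>C b)"
    using finite_dimensional by blast
  have span: "UNIV = complex_vector.span B"
    using B by (auto simp: complex_vector.span_finite)
  obtain C :: "'a set" where C: "complex_vector.independent C" "UNIV \<subseteq> complex_vector.span C"
      "card C = complex_vector.dim (UNIV :: 'a set)"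
    using complex_vector.basis_exists[of UNIV] by metis
  have "finite C"
    using complex_vector.independent_span_bound[OF B(1) C(1)] span by auto
  have "complex_vector.dependent (\<phi> ` T)"
  proof (rule ccontr)
    assume "complex_vector.independent (\<phi> ` T)"
    then have "card (\<phi> ` T) \<le> card C"
      using complex_vector.independent_span_bound[OF \<open>finite C\<close>] C(2) by auto
    then show False using assms(2) C(3) True by (simp add: card_image)
  qed
  then obtain u where "\<exists>v\<in>\<phi> ` T. u v \<noteq> 0" "(\<Sum>v\<in>\<phi> ` T. u v *\<^sub>C v) = 0"
    using complex_vector.dependent_finite[of "\<phi> ` T"] \<open>finite T\<close> by auto
  then show ?thesis
    using that[of "u \<circ> \<phi>"] True by (simp add: sum.reindex)
next
  case False
  then obtain x y where xy: "x \<in> T" "y \<in> T" "x \<noteq> y" "\<phi> x = \<phi> y"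
    unfolding inj_on_def by blast
  define c :: "'i \<Rightarrow> complex" where "c z = (if z = x then 1 else if z = y then - 1 else 0)" for z
  have "(\<Sum>z\<in>T. c z *\<^sub>C \<phi> z) = (\<Sum>z\<in>{x, y}. c z *\<^sub>C \<phi> z)"
    by (rule sum.mono_neutral_right) (use xy \<open>finite T\<close> in \<open>auto simp: c_def\<close>)
  also have "\<dots> = 0"
    using xy by (simp add: c_def)
  finally have "(\<Sum>z\<in>T. c z *\<^sub>C \<phi> z) = 0" .
  moreover have "c x \<noteq> 0" by (simp add: c_def)
  ultimately show ?thesis using that[of c] xy(1) by blast
qed

text \<open>Take a relation with the fewest terms. If it had more than \<open>dim + 1\<close> of
  them, some \<open>dim + 1\<close> of these vectors would satisfy a nontrivial linear relation; its
  coefficients can be absorbed into the vectors because the \<open>W x\<close> are subspaces, giving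
  a shorter relation.\<close>

lemma minimal_relation:
  fixes W :: "'i \<Rightarrow> 'a::hermitian_space set"
  assumes "\<And>x. x \<in> I \<Longrightarrow> complex_vector.subspace (W x)" and "\<not> independent_spaces I W"
  obtains S \<phi> where "finite S" "S \<noteq> {}" "S \<subseteq> I" "\<And>x. x \<in> S \<Longrightarrow> \<phi> x \<in> W x - {0}"
    "(\<Sum>x\<in>S. \<phi> x) = 0" "card S \<le> complex_vector.dim (UNIV :: 'a set) + 1"
proof -
  define R where "R S \<phi> \<longleftrightarrow> finite S \<and> S \<noteq> {} \<and> S \<subseteq> I \<and> (\<forall>x\<in>S. \<phi> x \<in> W x - {0}) \<and>
    (\<Sum>x\<in>S. \<phi> x) = 0" for S \<phi>
  obtain \<phi>\<^sub>0 where \<phi>\<^sub>0: "\<forall>x\<in>I. \<phi>\<^sub>0 x \<in> W x" "finite {x\<in>I. \<phi>\<^sub>0 x \<noteq> 0}"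
    "(\<Sum>x\<in>{x\<in>I. \<phi>\<^sub>0 x \<noteq> 0}. \<phi>\<^sub>0 x) = 0" "\<not> (\<forall>x\<in>I. \<phi>\<^sub>0 x = 0)"
    using assms(2) unfolding independent_spaces_def by blast
  then have "R {x\<in>I. \<phi>\<^sub>0 x \<noteq> 0} \<phi>\<^sub>0"
    unfolding R_def by auto
  then obtain S where "\<exists>\<phi>. R S \<phi>" and least: "\<And>T \<phi>. R T \<phi> \<Longrightarrow> card S \<le> card T"
    using exists_least_iff[of "\<lambda>n. \<exists>S. card S = n \<and> (\<exists>\<phi>. R S \<phi>)"] by (metis not_le)
  then obtain \<phi> where \<phi>: "R S \<phi>" by blast
  have "card S \<le> complex_vector.dim (UNIV :: 'a set) + 1"
  proof (rule ccontr)
    assume less: "\<not> card S \<le> complex_vector.dim (UNIV :: 'a set) + 1"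
    obtain T where T: "T \<subseteq> S" "card T = complex_vector.dim (UNIV :: 'a set) + 1"
      using obtain_subset_with_card_n[of _ S] less by (metis nle_le)
    then have "finite T" using \<phi> finite_subset unfolding R_def by blast
    then obtain c where c: "\<exists>x\<in>T. c x \<noteq> 0" "(\<Sum>x\<in>T. c x *\<^sub>C \<phi> x) = 0"
      using dim_less_card_imp_relation[of T \<phi>] T(2) by auto
    \<comment> \<open>Terms with zero coefficient are dropped, since \<open>R\<close> demands
      nonzero vectors.\<close>
    let ?T = "{x\<in>T. c x \<noteq> 0}"
    have "(\<Sum>x\<in>?T. c x *\<^sub>C \<phi> x) = (\<Sum>x\<in>T. c x *\<^sub>C \<phi> x)"
      by (rule sum.mono_neutral_left) (use \<open>finite T\<close> in auto)
    moreover have "c x *\<^sub>C \<phi> x \<in> W x - {0}" if "x \<in> ?T" for x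
    proof -
      have "x \<in> I" "\<phi> x \<in> W x" "\<phi> x \<noteq> 0" "c x \<noteq> 0"
        using that \<phi> T(1) unfolding R_def by auto
      then show ?thesis
        using complex_vector.subspace_scale[OF assms(1)] by simp
    qed
    moreover have "?T \<subseteq> I"
      using \<phi> T(1) unfolding R_def by blast
    ultimately have "R ?T (\<lambda>x. c x *\<^sub>C \<phi> x)"
      using c \<open>finite T\<close> unfolding R_def by auto
    then have "card S \<le> card ?T" by (rule least)
    also have "\<dots> \<le> card T" using \<open>finite T\<close> by (intro card_mono) auto
    finally show False using T(2) less by simp
  qed
  then show ?thesis using \<phi> unfolding R_def by (intro that[of S \<phi>]) auto
qed

lemma subspace_fixed_space:
  assumes "unitary_operator (U x)"
  shows "complex_vector.subspace (fixed_space U x)"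
  using assms unfolding complex_vector.subspace_def fixed_space_def unitary_operator_def
  by (auto simp: blinfun.diff_left blinfun.add_right blinfun.zero_right scaleC_add_right)

section \<open>Second-order estimates between points with equal values\<close>

text \<open>Both parts rest on \<open>k'\<close> being Lipschitz with constant \<open>K\<close>. The
  first is Taylor's estimate at 0. In the second, \<open>K \<le> 2 * d\<close> would make
  \<open>k\<close> strictly increase on each half of the interval, contrary to the equal end
  values.\<close>

lemma deriv_bound_of_equal_ends:
  fixes k k' k'' :: "real \<Rightarrow> real"
  assumes k: "\<And>t. t \<in> {0..1} \<Longrightarrow> (k has_real_derivative k' t) (at t within {0..1})"
    and k': "\<And>t. t \<in> {0..1} \<Longrightarrow> (k' has_real_derivative k'' t) (at t within {0..1})"
    and k'': "\<And>t. t \<in> {0..1} \<Longrightarrow> \<bar>k'' t\<bar> \<le> K"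
    and ends: "k 0 = k 1"
  shows "k' 0 \<le> K / 2"
    and "\<lbrakk>0 < d; d \<le> k' 0; d \<le> k' 1\<rbrakk> \<Longrightarrow> 2 * d < K"
proof -
  have lip: "\<bar>k' s - k' t\<bar> \<le> K * \<bar>s - t\<bar>" if "s \<in> {0..1}" "t \<in> {0..1}" for s t
    using field_differentiable_bound[of "{0..1}" k' k'' K, OF _ k' _ that] k'' by simp
  have interior: "(k has_real_derivative k' t) (at t)" if "0 < t" "t < 1" for t
    using k[of t] that by (simp add: at_within_Icc_at)
  have cont: "continuous_on {0..1} k"
    using k by (rule DERIV_continuous_on)
  show "k' 0 \<le> K / 2"
  proof -
    \<comment> \<open>The quadratic term makes the derivative \<open>k' t - k' 0 + K * t\<close>
      non-negative; with equal ends, \<open>h 0 \<le> h 1\<close> is the claim.\<close>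
    define h where "h t = k t - k' 0 * t + K * t\<^sup>2 / 2" for t
    have "h 0 \<le> h 1"
    proof (rule DERIV_nonneg_imp_increasing_open[where f = h])
      fix t :: real assume t: "0 < t" "t < 1"
      have "(h has_real_derivative (k' t - k' 0 + K * t)) (at t)"
        unfolding h_def
        by (rule derivative_eq_intros interior[OF t] refl | simp)+
      moreover have "0 \<le> k' t - k' 0 + K * t"
        using lip[of t 0] t by simp
      ultimately show "\<exists>y. (h has_real_derivative y) (at t) \<and> 0 \<le> y" by blast
    next
      show "continuous_on {0..1} h"
        unfolding h_def by (intro continuous_intros cont) auto
    qed simp
    then show ?thesis using ends by (simp add: h_def)
  qed
  show "2 * d < K" if d: "0 < d" "d \<le> k' 0" "d \<le> k' 1"
  proof (rule ccontr)
    assume "\<not> 2 * d < K"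
    then have K: "K \<le> 2 * d" by simp
    \<comment> \<open>Left of the midpoint the slope is at least \<open>d - K * t\<close>, measured
      from 0; right of it, at least \<open>d - K * (1 - t)\<close>, measured from 1. Both are
      positive on the open halves, and the slope at the midpoint itself may vanish.\<close>
    have "k 0 < k (1 / 2)"
    proof (rule DERIV_pos_imp_increasing_open[where f = k])
      fix t :: real assume t: "0 < t" "t < 1 / 2"
      have "K * t < d"
      proof -
        have "K * t \<le> 2 * d * t" using K t by (intro mult_right_mono) auto
        also have "\<dots> < 2 * d * (1 / 2)" using t d by (intro mult_strict_left_mono) auto
        finally show ?thesis by simp
      qed
      then have "0 < k' t" using lip[of 0 t] t d by simp
      then show "\<exists>y. (k has_real_derivative y) (at t) \<and> 0 < y" using interior[of t] t by auto
    qed (use continuous_on_subset[OF cont] in simp_all)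
    also have "k (1 / 2) < k 1"
    proof (rule DERIV_pos_imp_increasing_open[where f = k])
      fix t :: real assume t: "1 / 2 < t" "t < 1"
      have "K * (1 - t) < d"
      proof -
        have "K * (1 - t) \<le> 2 * d * (1 - t)" using K t by (intro mult_right_mono) auto
        also have "\<dots> < 2 * d * (1 / 2)" using t d by (intro mult_strict_left_mono) auto
        finally show ?thesis by simp
      qed
      then have "0 < k' t" using lip[of 1 t] t d by simp
      then show "\<exists>y. (k has_real_derivative y) (at t) \<and> 0 < y" using interior[of t] t by auto
    qed (use continuous_on_subset[OF cont] in simp_all)
    finally show False using ends by simp
  qed
qed

text \<open>The preceding estimates are applied to \<open>rinner (U x v) w\<close> along the segment
  from \<open>a\<close> to \<open>b\<close>. Rescaling to \<open>{0..1}\<close> treats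
  \<open>b < a\<close> and \<open>a < b\<close> alike and costs a factor \<open>b - a\<close> per
  derivative.\<close>

lemma chord_derivative_bounds:
  fixes U U' U'' :: "real \<Rightarrow> 'a::hermitian_space \<Rightarrow>\<^sub>L 'a"
  assumes J: "is_interval J" and ab: "a \<in> J" "b \<in> J" "a \<noteq> b"
    and U': "\<And>x. x \<in> J \<Longrightarrow> (U has_vector_derivative U' x) (at x within J)"
    and U'': "\<And>x. x \<in> J \<Longrightarrow> (U' has_vector_derivative U'' x) (at x within J)"
    and bound: "\<And>x. x \<in> J \<Longrightarrow> norm (U'' x) \<le> d\<^sub>2"
    and ends: "rinner (U a v) w = rinner (U b v) w"
  shows "\<bar>rinner (U' a v) w\<bar> \<le> \<bar>b - a\<bar> * d\<^sub>2 * (norm v * norm w) / 2"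
    and "\<lbrakk>0 < d; a < b; d \<le> rinner (U' a v) w; d \<le> rinner (U' b v) w\<rbrakk>
      \<Longrightarrow> 2 * d < (b - a) * d\<^sub>2 * (norm v * norm w)"
proof -
  define \<gamma> where "\<gamma> s = a + s * (b - a)" for s
  have \<gamma>: "\<gamma> s \<in> J" if "s \<in> {0..1}" for s
    using convexD_alt[OF is_interval_convex[OF J] ab(1,2), of s] that
    by (simp add: \<gamma>_def algebra_simps)
  have chain: "((\<lambda>s. rinner (F (\<gamma> s) v) u) has_real_derivative (b - a) * rinner (F' (\<gamma> s) v) u)
      (at s within {0..1})"
    if "\<And>x. x \<in> J \<Longrightarrow> (F has_vector_derivative F' x) (at x within J)" "s \<in> {0..1}"
    for F F' :: "real \<Rightarrow> 'a \<Rightarrow>\<^sub>L 'a" and u s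
  proof -
    have "bounded_linear (\<lambda>A :: 'a \<Rightarrow>\<^sub>L 'a. rinner (A v) u)"
      by (intro bounded_linear_compose[OF rinner.bounded_linear_left] blinfun.bounded_linear_left)
    then have "((\<lambda>x. rinner (F x v) u) has_real_derivative rinner (F' (\<gamma> s) v) u)
        (at (\<gamma> s) within J)"
      using bounded_linear.has_vector_derivative[OF _ that(1)[OF \<gamma>[OF that(2)]]]
      by (simp add: has_real_derivative_iff_has_vector_derivative)
    then have "((\<lambda>x. rinner (F x v) u) has_real_derivative rinner (F' (\<gamma> s) v) u)
        (at (\<gamma> s) within \<gamma> ` {0..1})"
      by (rule DERIV_subset) (use \<gamma> in auto)
    moreover have "(\<gamma> has_real_derivative b - a) (at s within {0..1})"
      unfolding \<gamma>_def by (auto intro!: derivative_eq_intros)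
    ultimately show ?thesis
      by (subst mult.commute) (rule DERIV_image_chain[unfolded o_def])
  qed
  have second: "\<bar>(b - a) * ((b - a) * rinner (U'' (\<gamma> s) v) u)\<bar> \<le>
      (b - a)\<^sup>2 * (d\<^sub>2 * (norm v * norm u))" if "s \<in> {0..1}" for s u
  proof -
    have "\<bar>rinner (U'' (\<gamma> s) v) u\<bar> \<le> norm (U'' (\<gamma> s) v) * norm u"
      by (rule rinner_le_norm)
    also have "\<dots> \<le> norm (U'' (\<gamma> s)) * norm v * norm u"
      by (intro mult_right_mono norm_blinfun) simp
    also have "\<dots> \<le> d\<^sub>2 * norm v * norm u"
      using bound[OF \<gamma>[OF that]] by (intro mult_right_mono) auto
    finally have "(b - a)\<^sup>2 * \<bar>rinner (U'' (\<gamma> s) v) u\<bar> \<le> (b - a)\<^sup>2 * (d\<^sub>2 * norm v * norm u)"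
      by (intro mult_left_mono) auto
    moreover have "\<bar>(b - a) * ((b - a) * rinner (U'' (\<gamma> s) v) u)\<bar> =
        (b - a)\<^sup>2 * \<bar>rinner (U'' (\<gamma> s) v) u\<bar>"
      by (simp only: abs_mult power2_eq_square mult.assoc[symmetric] abs_mult_self_eq)
    ultimately show ?thesis by (simp only: mult.assoc)
  qed
  \<comment> \<open>The vector \<open>u\<close> stays free because the upper bound is used for both
    \<open>w\<close> and \<open>- w\<close>, which yields the absolute value.\<close>
  have main: "(b - a) * rinner (U' (\<gamma> 0) v) u \<le> (b - a)\<^sup>2 * (d\<^sub>2 * (norm v * norm u)) / 2"
    "\<And>e. \<lbrakk>0 < e; e \<le> (b - a) * rinner (U' (\<gamma> 0) v) u; e \<le> (b - a) * rinner (U' (\<gamma> 1) v) u\<rbrakk>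
      \<Longrightarrow> 2 * e < (b - a)\<^sup>2 * (d\<^sub>2 * (norm v * norm u))"
    if "rinner (U a v) u = rinner (U b v) u" for u
  proof -
    let ?k = "\<lambda>s. rinner (U (\<gamma> s) v) u" and ?k' = "\<lambda>s. (b - a) * rinner (U' (\<gamma> s) v) u"
    have k: "(?k has_real_derivative ?k' s) (at s within {0..1})" if "s \<in> {0..1}" for s
      using chain[OF U' that] .
    have k': "(?k' has_real_derivative (b - a) * ((b - a) * rinner (U'' (\<gamma> s) v) u))
        (at s within {0..1})" if "s \<in> {0..1}" for s
      using DERIV_cmult[OF chain[OF U'' that]] .
    have "?k 0 = ?k 1" using that by (simp add: \<gamma>_def)
    note bounds = deriv_bound_of_equal_ends[OF k k' second this]
    show "?k' 0 \<le> (b - a)\<^sup>2 * (d\<^sub>2 * (norm v * norm u)) / 2"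
      by (rule bounds(1))
    show "2 * e < (b - a)\<^sup>2 * (d\<^sub>2 * (norm v * norm u))"
      if "0 < e" "e \<le> ?k' 0" "e \<le> ?k' 1" for e
      by (rule bounds(2)) (use that in auto)
  qed
  have "(b - a) * rinner (U' a v) w \<le> (b - a)\<^sup>2 * (d\<^sub>2 * (norm v * norm w)) / 2"
    using main(1)[OF ends] by (simp add: \<gamma>_def)
  moreover have "(b - a) * - rinner (U' a v) w \<le> (b - a)\<^sup>2 * (d\<^sub>2 * (norm v * norm w)) / 2"
    using main(1)[of "- w"] ends by (simp add: \<gamma>_def rinner.minus_right)
  ultimately have "\<bar>(b - a) * rinner (U' a v) w\<bar> \<le> (b - a)\<^sup>2 * (d\<^sub>2 * (norm v * norm w)) / 2"
    by linarith
  then have "\<bar>b - a\<bar> * \<bar>rinner (U' a v) w\<bar> \<le>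
      \<bar>b - a\<bar> * (\<bar>b - a\<bar> * d\<^sub>2 * (norm v * norm w) / 2)"
    by (simp only: abs_mult power2_abs[of "b - a", symmetric] power2_eq_square mult.assoc
        times_divide_eq_right)
  then show "\<bar>rinner (U' a v) w\<bar> \<le> \<bar>b - a\<bar> * d\<^sub>2 * (norm v * norm w) / 2"
    using ab(3) by (simp only: mult_le_cancel_left_pos[of "\<bar>b - a\<bar>"] zero_less_abs_iff)
  show "2 * d < (b - a) * d\<^sub>2 * (norm v * norm w)"
    if d: "0 < d" "a < b" "d \<le> rinner (U' a v) w" "d \<le> rinner (U' b v) w"
  proof -
    have "2 * ((b - a) * d) < (b - a)\<^sup>2 * (d\<^sub>2 * (norm v * norm w))"
      using d by (intro main(2)[OF ends]) (auto simp: \<gamma>_def)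
    then have "(b - a) * (2 * d) < (b - a) * ((b - a) * d\<^sub>2 * (norm v * norm w))"
      by (simp add: power2_eq_square mult_ac)
    then show ?thesis using d(2) by (simp only: mult_less_cancel_left_pos[of "b - a"] diff_gt_0_iff_gt)
  qed
qed

section \<open>Unitary operators and their fixed vectors\<close>

lemma cinner_scaleC_right: "cinner v (a *\<^sub>C w) = cnj a * cinner v w"
  by (metis cinner_commute cinner_scaleC_left complex_cnj_mult)

lemma norm_scaleC_ii: "norm (\<i> *\<^sub>C v) = norm v"
  by (simp add: norm_eq_sqrt_cinner cinner_scaleC_left cinner_scaleC_right)

text \<open>By complex linearity \<open>A\<close> also fixes \<open>\<i> *\<^sub>C w\<close>, and it
  preserves the form. This supplies the equal end values required by
  \<open>chord_derivative_bounds\<close>.\<close>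

lemma rinner_unitary_fixed_ii:
  assumes "unitary_operator A" "A w = w"
  shows "rinner (A v) (\<i> *\<^sub>C w) = rinner v (\<i> *\<^sub>C w)"
proof -
  have "A (\<i> *\<^sub>C w) = \<i> *\<^sub>C w" using assms by (simp add: unitary_operator_def)
  then show ?thesis
    using assms(1) unfolding rinner_def unitary_operator_def by metis
qed

lemma inj_unitary_operator:
  assumes "unitary_operator A"
  shows "inj (blinfun_apply A)"
proof (rule injI)
  fix v w assume "A v = A w"
  then have "norm (A (v - w)) = 0" by (simp add: blinfun.diff_right)
  moreover have "norm (A (v - w)) = norm (v - w)"
    using assms by (simp add: unitary_operator_def norm_eq_sqrt_cinner)
  ultimately show "v = w" by simp
qed

text \<open>The inverse of \<open>U x\<close> fixes \<open>v\<close> as well, and the scalar 1/i =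
  -i becomes i when moved to the conjugate-linear second argument.\<close>

lemma velocity_fixed:
  assumes "unitary_operator (U x)" "v \<in> fixed_space U x"
  shows "Re (cinner (velocity J U x v) v) = rinner (deriv_on J U x v) (\<i> *\<^sub>C v)"
proof -
  have "inv (blinfun_apply (U x)) v = v"
    using assms by (intro inv_f_eq inj_unitary_operator) (auto simp: fixed_space_def blinfun.diff_left)
  then show ?thesis
    unfolding velocity_def cinner_scaleC_left rinner_def cinner_scaleC_right by simp
qed

section \<open>Contradiction from a shortest relation\<close>

theorem theorem2:
  fixes U :: "real \<Rightarrow> 'a::hermitian_space \<Rightarrow>\<^sub>L 'a"
    and J I\<^sub>0 :: "real set"
    and M :: nat
    and d_min d_max d_2 :: real
  assumes "complex_vector.dim (UNIV :: 'a set) = M"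
    and "is_interval J"
    and "monotone_unitary_family J U"
    and "0 < d_min" and "0 < d_max" and "0 < d_2"
    and "\<And>x. x \<in> J \<Longrightarrow> op_le (\<lambda>v. d_min *\<^sub>R v) (velocity J U x)"
    and "\<And>x. x \<in> J \<Longrightarrow> op_le (velocity J U x) (\<lambda>v. d_max *\<^sub>R v)"
    and "\<And>x. x \<in> J \<Longrightarrow> norm (deriv_on J (deriv_on J U) x) \<le> d_2"
    and "I\<^sub>0 \<subseteq> J" and "is_interval I\<^sub>0" and "bounded I\<^sub>0"
    and "diameter I\<^sub>0 \<le> 2 * d_min / (d_2 * real M)"
  shows "independent_spaces (I\<^sub>0 \<inter> singular_points J U) (fixed_space U)"
proof (rule ccontr)
  assume contra: "\<not> ?thesis"
  have unitary: "unitary_operator (U x)" if "x \<in> J" for x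
    using assms(3) that by (simp add: monotone_unitary_family_def unitary_family_def)
  have analytic: "real_analytic_on U J"
    using assms(3) by (simp add: monotone_unitary_family_def unitary_family_def)
  have subspace: "complex_vector.subspace (fixed_space U x)" if "x \<in> I\<^sub>0 \<inter> singular_points J U" for x
    using that assms(10) by (intro subspace_fixed_space unitary) auto
  obtain S \<phi> where S: "finite S" "S \<noteq> {}" "S \<subseteq> I\<^sub>0 \<inter> singular_points J U"
    and \<phi>: "\<And>x. x \<in> S \<Longrightarrow> \<phi> x \<in> fixed_space U x - {0}" "(\<Sum>x\<in>S. \<phi> x) = 0"
    and card: "card S \<le> M + 1"
    using minimal_relation[OF subspace contra] assms(1) by metis
  have SJ: "x \<in> J" if "x \<in> S" for x using that S(3) assms(10) by auto
  have fixed: "U x (\<phi> x) = \<phi> x" if "x \<in> S" for x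
    using \<phi>(1)[OF that] by (simp add: fixed_space_def blinfun.diff_left)
  have "card S \<noteq> 0" using S by simp
  moreover have "card S \<noteq> 1"
    using \<phi> by (auto simp: card_1_singleton_iff)
  ultimately have card2: "2 \<le> card S" by linarith
  \<comment> \<open>This excludes a zero denominator in \<open>L\<close>, which is needed for
    \<open>L\<close> to be positive.\<close>
  then have M: "1 \<le> M" using card by simp
  define L where "L = 2 * d_min / (d_2 * real M)"
  have d_2_L: "d_2 * (real M * L) = 2 * d_min"
    using M assms(6) by (simp add: L_def)
  have L0: "0 < L" using M assms(4,6) by (simp add: L_def)
  have dist: "\<bar>x - y\<bar> \<le> L" if "x \<in> S" "y \<in> S" for x y
  proof -
    have "x \<in> I\<^sub>0" "y \<in> I\<^sub>0" using that S(3) by auto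
    then show ?thesis
      using diameter_bounded_bound[OF assms(12), of x y] assms(13)
      by (simp add: dist_real_def L_def)
  qed
  \<comment> \<open>\<open>J\<close> is connected and contains the at least two points of
    \<open>S\<close>, so it has no isolated points and derivatives within \<open>J\<close> are
    meaningful.\<close>
  have limpt: "x islimpt J" if "x \<in> J" for x
  proof (rule connected_imp_perfect[OF _ that])
    show "connected J" using assms(2) by (rule is_interval_connected)
    show "J \<noteq> {a}" for a
    proof
      assume "J = {a}"
      then have "S \<subseteq> {a}" using SJ by auto
      then have "card S \<le> 1" using card_mono[of "{a}" S] by simp
      then show False using card2 by simp
    qed
  qed
  note deriv = real_analytic_on_blinfun_derivatives[OF analytic limpt]
  note chord = chord_derivative_bounds[OF assms(2) _ _ _ deriv(1) deriv(2) assms(9)]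
  have lower: "d_min * (norm v)\<^sup>2 \<le> rinner (deriv_on J U x v) (\<i> *\<^sub>C v)"
    if "x \<in> J" "v \<in> fixed_space U x" for x v
  proof -
    have "d_min * (norm v)\<^sup>2 = Re (cinner (d_min *\<^sub>R v) v)"
      by (simp add: rinner_scaleR_left rinner_self flip: rinner_def)
    also have "\<dots> \<le> Re (cinner (velocity J U x v) v)"
      using assms(7)[OF that(1)] by (simp add: op_le_def)
    also have "\<dots> = rinner (deriv_on J U x v) (\<i> *\<^sub>C v)"
      by (rule velocity_fixed[OF unitary[OF that(1)] that(2)])
    finally show ?thesis .
  qed
  show False
  proof (cases "card S = 2")
    case True
    then obtain a b where ab: "S = {a, b}" "a < b"
    proof -
      obtain x y where xy: "S = {x, y}" "x \<noteq> y" using True by (auto simp: card_2_iff)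
      show ?thesis
        using that[of x y] that[of y x] xy by (cases "x < y") (auto simp: insert_commute)
    qed
    let ?v = "\<phi> a"
    have "\<phi> b = - ?v" using \<phi>(2) ab by (simp add: eq_neg_iff_add_eq_0 add.commute)
    then have "?v \<in> fixed_space U b"
      using fixed[of b] ab by (simp add: fixed_space_def blinfun.diff_left blinfun.minus_right)
    moreover have "?v \<in> fixed_space U a" "?v \<noteq> 0" using \<phi>(1)[of a] ab by auto
    ultimately have va: "U a ?v = ?v" "U b ?v = ?v" and v: "?v \<in> fixed_space U a"
        "?v \<in> fixed_space U b" "0 < (norm ?v)\<^sup>2"
      by (auto simp: fixed_space_def blinfun.diff_left)
    have "2 * (d_min * (norm ?v)\<^sup>2) < (b - a) * d_2 * (norm ?v * norm (\<i> *\<^sub>C ?v))"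
      using ab SJ v lower assms(4) va by (intro chord(2)) auto
    also have "\<dots> \<le> L * d_2 * (norm ?v)\<^sup>2"
      using dist[of b a] ab assms(6)
      by (auto simp: norm_scaleC_ii power2_eq_square intro!: mult_right_mono)
    finally have "2 * d_min < L * d_2" using v(3) by simp
    \<comment> \<open>For \<open>M = 1\<close> this is an equality, so the contradiction depends on
      the strict inequality from \<open>chord(2)\<close>.\<close>
    moreover have "L * d_2 \<le> d_2 * (real M * L)"
      using M L0 assms(6) by simp
    ultimately show False using d_2_L by simp
  next
    case False
    then have card3: "3 \<le> card S" using card2 by simp
    obtain i where i: "i \<in> S" "\<And>j. j \<in> S \<Longrightarrow> norm (\<phi> j) \<le> norm (\<phi> i)"
    proof -
      have "Max ((norm \<circ> \<phi>) ` S) \<in> (norm \<circ> \<phi>) ` S" using S by (intro Max_in) auto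
      then obtain i where "i \<in> S" "Max ((norm \<circ> \<phi>) ` S) = norm (\<phi> i)" by auto
      then show ?thesis using that[of i] S(1) by (metis Max_ge comp_apply finite_imageI imageI)
    qed
    let ?U' = "deriv_on J U i" and ?w = "\<i> *\<^sub>C \<phi> i" and ?n = "norm (\<phi> i)"
    have n: "0 < ?n" using \<phi>(1)[OF i(1)] by simp
    have off_diagonal: "- rinner (?U' (\<phi> j)) ?w \<le> \<bar>j - i\<bar> * (d_2 * ?n\<^sup>2 / 2)" if "j \<in> S - {i}" for j
    proof -
      have j: "j \<in> S" "j \<noteq> i" using that by auto
      \<comment> \<open>Both sides equal \<open>rinner (\<phi> j) ?w\<close>: the left because
        \<open>U i\<close> fixes \<open>\<phi> i\<close>, the right because \<open>U j\<close> fixes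
        \<open>\<phi> j\<close>.\<close>
      have "rinner (U i (\<phi> j)) ?w = rinner (U j (\<phi> j)) ?w"
        using rinner_unitary_fixed_ii[OF unitary[OF SJ[OF i(1)]] fixed[OF i(1)]] fixed[OF j(1)]
        by simp
      then have "\<bar>rinner (?U' (\<phi> j)) ?w\<bar> \<le> \<bar>j - i\<bar> * d_2 * (norm (\<phi> j) * norm ?w) / 2"
        using j i(1) SJ by (intro chord(1)) auto
      also have "\<dots> \<le> \<bar>j - i\<bar> * d_2 * (?n * ?n) / 2"
        unfolding norm_scaleC_ii using i(2)[OF j(1)] assms(6)
        by (intro divide_right_mono mult_left_mono mult_right_mono) auto
      finally show ?thesis by (simp add: power2_eq_square)
    qed
    have "0 = rinner (?U' (\<Sum>j\<in>S. \<phi> j)) ?w"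
      by (simp add: \<phi>(2) blinfun.zero_right rinner.zero_left)
    also have "\<dots> = rinner (?U' (\<phi> i)) ?w + (\<Sum>j\<in>S - {i}. rinner (?U' (\<phi> j)) ?w)"
      using S(1) i(1) by (simp add: blinfun.sum_right blinfun.add_right rinner.sum_left rinner_add_left
          sum.remove)
    finally have "rinner (?U' (\<phi> i)) ?w = (\<Sum>j\<in>S - {i}. - rinner (?U' (\<phi> j)) ?w)"
      by (simp add: sum_negf)
    also have "\<dots> \<le> (\<Sum>j\<in>S - {i}. \<bar>j - i\<bar> * (d_2 * ?n\<^sup>2 / 2))"
      by (rule sum_mono) (rule off_diagonal)
    also have "\<dots> = (\<Sum>j\<in>S - {i}. \<bar>j - i\<bar>) * (d_2 * ?n\<^sup>2 / 2)"
      by (simp add: sum_distrib_right)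
    also have "\<dots> < (real M * L) * (d_2 * ?n\<^sup>2 / 2)"
    proof (rule mult_strict_right_mono)
      \<comment> \<open>Two distinct points at distance exactly \<open>L\<close> from
        \<open>i\<close> are \<open>i - L\<close> and \<open>i + L\<close>, hence
        \<open>2 * L\<close> apart, which is too far. This uses at least three points in
        \<open>S\<close>.\<close>
      have "\<exists>j\<in>S - {i}. \<bar>j - i\<bar> < L"
      proof (rule ccontr)
        assume "\<not> ?thesis"
        then have far: "\<bar>j - i\<bar> = L" if "j \<in> S - {i}" for j
          using that dist[OF _ i(1), of j] by force
        have "2 \<le> card (S - {i})" using card3 i(1) S(1) by simp
        then obtain j k where "j \<in> S - {i}" "k \<in> S - {i}" "j \<noteq> k"
          using card_le_Suc0_iff_eq[of "S - {i}"] S(1) by force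
        then show False using far[of j] far[of k] dist[of j k] L0 by auto
      qed
      then have "(\<Sum>j\<in>S - {i}. \<bar>j - i\<bar>) < (\<Sum>j\<in>S - {i}. L)"
        using S(1) dist[OF _ i(1)] by (intro sum_strict_mono_ex1) auto
      also have "\<dots> = real (card (S - {i})) * L" by simp
      also have "\<dots> \<le> real M * L"
        using card S(1) i(1) L0 by (intro mult_right_mono) auto
      finally show "(\<Sum>j\<in>S - {i}. \<bar>j - i\<bar>) < real M * L" .
    qed (use assms(6) n in simp)
    also have "\<dots> = (d_2 * (real M * L)) * (?n\<^sup>2 / 2)" by simp
    also have "\<dots> = d_min * ?n\<^sup>2" unfolding d_2_L by simp
    finally show False
      using lower[OF SJ[OF i(1)], of "\<phi> i"] \<phi>(1)[OF i(1)] by simp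
  qed
qed

end
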